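(* Let $\phi$ be a formula of ERL. If there exists a tableaux proof for $\phi$ (a closed tableau for the constrained set of statements $\langle\{(\mathbb F,\phi,c_1)\},\{c_1\approx c_1\}\rangle$), then $\phi$ is valid.
   Context: SEMANTICS. Fix a finite set $A$ of agents, a finite set $Res$ of resources containing $e$ with a partial operation $\cdot$, and a countable set $\mathrm{Prop}$ of atoms. Formulas: $\phi ::= p \mid \bot \mid \top \mid \neg\phi \mid I \mid \phi\vee\phi \mid \phi\wedge\phi \mid \phi\to\phi \mid \phi*\phi \mid \phi\mathbin{-\!*}\phi \mid C_u^r\phi \mid D_u^r\phi \mid E_u^r\phi \mid \widehat C_u^r\phi\mid\widehat D_u^r\phi\mid\widehat E_u^r\phi$ ($u\in A$, $r\in Res$), where $\widehat X_u^r\phi$ abbreviates $\neg X_u^r\neg\phi$. A partial resource monoid is $(R,\bullet)$ with $Res\subseteq R$, $\bullet$ partial, such that for all $r_1,r_2,r_3\in R$: if all lie in $Res$ then $r_1=r_2\cdot r_3$ iff $r_1=r_2\bullet r_3$; $r_1\bullet e$ is defined and equals $r_1$; $\bullet$ is commutative (if $r_1\bullet r_2$ is defined so is $r_2\bullet r_1$ and they are equal); associative (if $r_1\bullet(r_2\bullet r_3)$ is defined so is $(r_1\bullet r_2)\bullet r_3$ and they are equal). A model is $\mathcal M=((R,\bullet),\{\sim_u\}_{u\in A},V)$, each $\sim_u$ an equivalence on $R$, $V:\mathrm{Prop}\to\wp(R)$. Satisfaction: atoms via $V$; $\bot$ never; $\top$ always; classical $\neg,\vee,\wedge,\to$; $r\models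 I$ iff $r=e$; $r\models\phi*\psi$ iff $r=r_1\bullet r_2$ (defined) with $r_1\models\phi,r_2\models\psi$; $r\models\phi\mathbin{-\!*}\psi$ iff for all $r'$ with $r\bullet r'$ defined and $r'\models\phi$, $r\bullet r'\models\psi$; $r\models C_u^s\phi$ iff, if $r\bullet s$ is defined, all $r'$ with $r\bullet s\sim_u r'$ satisfy $\phi$; $r\models D_u^s\phi$ iff some $r'$ has $r'\bullet s$ defined, $r\sim_u r'\bullet s$, $r'\bullet s\models\phi$; $r\models E_u^s\phi$ iff, if $r\bullet s$ is defined, every $r'$ with $r'\bullet s$ defined and $r\bullet s\sim_u r'\bullet s$ has $r'\bullet s\models\phi$. Valid = satisfied at every resource of every model. LABELS AND CONSTRAINTS. Let $\Lambda_r$ be a finite set of constants with $|\Lambda_r|=|Res|-1$, and $\gamma_r=\Lambda_r\cup\{c_1,c_2,\dots\}$ a countably infinite set of constants. A (resource) label is a finite multiset over $\gamma_r$, written as a word with letter order ignored; $xy$ is multiset union, $\epsilon$ the empty label; $y$ is a sublabel of $x$ if $x=yz$ for some $z$. Fix a bijection $\lambda:Res\to\Lambda_r\cup\{\epsilon\}$ with $\lambda(e)=\epsilon$. A resource constraint is $x\approx y$; an agent constraint is $x\asymp_u y$ ($u\in A$), $x,y$ labels. For a set $\mathcal C$ of constraints, $\mathcal D(\mathcal C)$ is the set of all sublabels of labels occurring in $\mathcal C$, and $\mathcal A(\mathcal C)$ the set of constants occurring in $\mathcal C$. The closure $\overline{\mathcal C}$ is the least superset of $\mathcal C$ closed under: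 $\epsilon\approx\epsilon$; $x\approx y\Rightarrow y\approx x$; $xy\approx xy\Rightarrow x\approx x$; $x\approx y,\ y\approx z\Rightarrow x\approx z$; $x\approx y,\ yk\approx yk\Rightarrow xk\approx yk$; $x\asymp_u y\Rightarrow x\approx x$; $x\approx x\Rightarrow x\asymp_v x$ (every $v\in A$); $x\asymp_u y\Rightarrow y\asymp_u x$; $x\asymp_u y,\ y\asymp_u z\Rightarrow x\asymp_u z$; $x\asymp_u y,\ x\approx k\Rightarrow k\asymp_u y$. TABLEAUX. A labelled formula is $(S,\phi,x)$ with $S\in\{\mathbb T,\mathbb F\}$, $\phi$ a formula, $x$ a label. A CSS is a pair $\langle\mathcal F,\mathcal C\rangle$ of a set of labelled formulae and a set of constraints such that $(S,\phi,x)\in\mathcal F$ implies $x\approx x\in\overline{\mathcal C}$. A tableau for a finite CSS is a list of CSSs (branches): the one-element list is a tableau, and if $\langle\mathcal F,\mathcal C\rangle$ is a branch and a rule below with premise satisfied yields alternatives $\langle\mathcal F_1,\mathcal C_1\rangle\mid\dots\mid\langle\mathcal F_k,\mathcal C_k\rangle$, the branch may be replaced by $\langle\mathcal F\cup\mathcal F_i,\mathcal C\cup\mathcal C_i\rangle$, $i=1..k$. Rules ($\bar r:=\lambda(r)$; "new" $c_i\neq c_j$ are constants in $\gamma_r\setminus(\mathcal A(\mathcal C)\cup\Lambda_r)$): $\mathbb T I$ at $x$: add $x\approx\epsilon$. $\mathbb T\neg\phi$ at $x$: add $(\mathbb F,\phi,x)$; $\mathbb F\neg\phi$: add $(\mathbb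 T,\phi,x)$. $\mathbb T\wedge$: add both conjuncts true; $\mathbb F\wedge$: split $\mathbb F\phi$ | $\mathbb F\psi$ at $x$. $\mathbb T\vee$: split; $\mathbb F\vee$: both false. $\mathbb T\to$: split $\mathbb F\phi$ | $\mathbb T\psi$; $\mathbb F\to$: add $\mathbb T\phi,\mathbb F\psi$. $\mathbb T(\phi*\psi)$ at $x$: new $c_i,c_j$, add $(\mathbb T,\phi,c_i),(\mathbb T,\psi,c_j)$ and $x\approx c_ic_j$. $\mathbb F(\phi*\psi)$ at $x$, if $x\approx yz\in\overline{\mathcal C}$: split $(\mathbb F,\phi,y)$ | $(\mathbb F,\psi,z)$. $\mathbb T(\phi\mathbin{-\!*}\psi)$ at $x$, if $xy\approx xy\in\overline{\mathcal C}$: split $(\mathbb F,\phi,y)$ | $(\mathbb T,\psi,xy)$. $\mathbb F(\phi\mathbin{-\!*}\psi)$ at $x$: new $c_i$, add $(\mathbb T,\phi,c_i),(\mathbb F,\psi,xc_i)$, $xc_i\approx xc_i$. $\mathbb T C_u^r\phi$ at $x$, if $x\bar r\asymp_u y\in\overline{\mathcal C}$: add $(\mathbb T,\phi,y)$. $\mathbb F C_u^r\phi$: new $c_i$, add $(\mathbb F,\phi,c_i)$, $x\bar r\asymp_u c_i$. $\mathbb T D_u^r\phi$: new $c_i$, add $(\mathbb T,\phi,c_i\bar r)$, $x\asymp_u c_i\bar r$. $\mathbb F D_u^r\phi$, if $x\asymp_u y\bar r\in\overline{\mathcal C}$: add $(\mathbb F,\phi,y\bar r)$. $\mathbb T E_u^r\phi$,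 if $x\bar r\asymp_u y\bar r\in\overline{\mathcal C}$: add $(\mathbb T,\phi,y\bar r)$. $\mathbb F E_u^r\phi$: new $c_i$, add $(\mathbb F,\phi,c_i\bar r)$, $x\bar r\asymp_u c_i\bar r$. $\mathbb T\widehat C_u^r\phi$: new $c_i$, add $(\mathbb T,\phi,c_i)$, $x\bar r\asymp_u c_i$. $\mathbb F\widehat C_u^r\phi$, if $x\bar r\asymp_u y\in\overline{\mathcal C}$: add $(\mathbb F,\phi,y)$. $\mathbb T\widehat D_u^r\phi$, if $x\asymp_u y\bar r\in\overline{\mathcal C}$: add $(\mathbb T,\phi,y\bar r)$. $\mathbb F\widehat D_u^r\phi$: new $c_i$, add $(\mathbb F,\phi,c_i\bar r)$, $x\asymp_u c_i\bar r$. $\mathbb T\widehat E_u^r\phi$: new $c_i$, add $(\mathbb T,\phi,c_i\bar r)$, $x\bar r\asymp_u c_i\bar r$. $\mathbb F\widehat E_u^r\phi$, if $x\bar r\asymp_u y\bar r\in\overline{\mathcal C}$: add $(\mathbb F,\phi,y\bar r)$. A CSS is closed if (1) $(\mathbb T,\phi,x),(\mathbb F,\phi,y)\in\mathcal F$ with $x\approx y\in\overline{\mathcal C}$, or (2) $(\mathbb F,I,x)\in\mathcal F$ with $x\approx\epsilon\in\overline{\mathcal C}$, or (3) $(\mathbb F,\top,x)\in\mathcal F$, or (4) $(\mathbb T,\bot,x)\in\mathcal F$. A tableau is closed if all its branches are closed; a tableaux proof for $\phi$ is a closed tableau for $\langle\{(\mathbb F,\phi,c_1)\},\{c_1\approx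 c_1\}\rangle$. *)

theory Defs
  imports "HOL-Library.Multiset" "HOL-Library.Countable_Set"
begin

datatype ('p, 'a, 'r) form =
    Atom 'p
  | Bot
  | Top
  | Neg "('p, 'a, 'r) form"
  | Emp
  | Or "('p, 'a, 'r) form" "('p, 'a, 'r) form"
  | And "('p, 'a, 'r) form" "('p, 'a, 'r) form"
  | Imp "('p, 'a, 'r) form" "('p, 'a, 'r) form"
  | Star "('p, 'a, 'r) form" "('p, 'a, 'r) form"
  | Wand "('p, 'a, 'r) form" "('p, 'a, 'r) form"
  | CMod 'a 'r "('p, 'a, 'r) form"
  | DMod 'a 'r "('p, 'a, 'r) form"
  | EMod 'a 'r "('p, 'a, 'r) form"

abbreviation CHat :: "'a \<Rightarrow> 'r \<Rightarrow> ('p, 'a, 'r) form \<Rightarrow> ('p, 'a, 'r) form"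
  where "CHat u r \<phi> \<equiv> Neg (CMod u r (Neg \<phi>))"

abbreviation DHat :: "'a \<Rightarrow> 'r \<Rightarrow> ('p, 'a, 'r) form \<Rightarrow> ('p, 'a, 'r) form"
  where "DHat u r \<phi> \<equiv> Neg (DMod u r (Neg \<phi>))"

abbreviation EHat :: "'a \<Rightarrow> 'r \<Rightarrow> ('p, 'a, 'r) form \<Rightarrow> ('p, 'a, 'r) form"
  where "EHat u r \<phi> \<equiv> Neg (EMod u r (Neg \<phi>))"

record ('p, 'a, 'r) model =
  Carr :: "'r set"
  comp :: "'r \<Rightarrow> 'r \<Rightarrow> 'r option"
  sim :: "'a \<Rightarrow> ('r \<times> 'r) set"
  val :: "'p \<Rightarrow> 'r set"

type_synonym 'k label = "'k multiset"

datatype ('a, 'k) constr =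
    ResC "'k label" "'k label"
  | AgC 'a "'k label" "'k label"

datatype sign = TT | FF

type_synonym ('p, 'a, 'r, 'k) lform = "sign \<times> ('p, 'a, 'r) form \<times> 'k label"
type_synonym ('p, 'a, 'r, 'k) css = "('p, 'a, 'r, 'k) lform set \<times> ('a, 'k) constr set"

fun constr_labels :: "('a, 'k) constr \<Rightarrow> 'k label set" where
  "constr_labels (ResC x y) = {x, y}"
| "constr_labels (AgC u x y) = {x, y}"

definition constants_of :: "('a, 'k) constr set \<Rightarrow> 'k set" where
  "constants_of C = (\<Union>k\<in>C. \<Union>x\<in>constr_labels k. set_mset x)"

text \<open>
  Partial operations are option-valued, None meaning undefined.  The resources \<open>Res\<close> and the
  carriers of all models live in one type \<open>'r\<close>, so that a model satisfies \<open>Res \<subseteq> R\<close> literally.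
  \<open>Lam\<close> is the set of constants naming the elements of \<open>Res\<close> other than \<open>e\<close>; the further
  constants are \<open>c i\<close> with \<open>i \<ge> 1\<close> (the value \<open>c 0\<close> is not used).
\<close>

locale erl =
  fixes Agents :: "'a set"
    and Res :: "'r set"
    and e :: 'r
    and rop :: "'r \<Rightarrow> 'r \<Rightarrow> 'r option"
    and Props :: "'p set"
    and Lam :: "'k set"
    and c :: "nat \<Rightarrow> 'k"
    and lam :: "'r \<Rightarrow> 'k label"
  assumes finite_Agents: "finite Agents"
    and finite_Res: "finite Res"
    and e_in_Res: "e \<in> Res"
    and rop_closed: "\<And>r s t. r \<in> Res \<Longrightarrow> s \<in> Res \<Longrightarrow> rop r s = Some t \<Longrightarrow> t \<in> Res"
    and countable_Props: "countable Props"
    and finite_Lam: "finite Lam"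
    and card_Lam: "card Lam = card Res - 1"
    and inj_c: "inj_on c {1..}"
    and c_notin_Lam: "c ` {1..} \<inter> Lam = {}"
    and bij_lam: "bij_betw lam Res (insert {#} ((\<lambda>k. {#k#}) ` Lam))"
    and lam_e: "lam e = {#}"
begin

primrec formula :: "('p, 'a, 'r) form \<Rightarrow> bool" where
  "formula (Atom p) \<longleftrightarrow> p \<in> Props"
| "formula Bot \<longleftrightarrow> True"
| "formula Top \<longleftrightarrow> True"
| "formula (Neg \<phi>) \<longleftrightarrow> formula \<phi>"
| "formula Emp \<longleftrightarrow> True"
| "formula (Or \<phi> \<psi>) \<longleftrightarrow> formula \<phi> \<and> formula \<psi>"
| "formula (And \<phi> \<psi>) \<longleftrightarrow> formula \<phi> \<and> formula \<psi>"
| "formula (Imp \<phi> \<psi>) \<longleftrightarrow> formula \<phi> \<and> formula \<psi>"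
| "formula (Star \<phi> \<psi>) \<longleftrightarrow> formula \<phi> \<and> formula \<psi>"
| "formula (Wand \<phi> \<psi>) \<longleftrightarrow> formula \<phi> \<and> formula \<psi>"
| "formula (CMod u r \<phi>) \<longleftrightarrow> u \<in> Agents \<and> r \<in> Res \<and> formula \<phi>"
| "formula (DMod u r \<phi>) \<longleftrightarrow> u \<in> Agents \<and> r \<in> Res \<and> formula \<phi>"
| "formula (EMod u r \<phi>) \<longleftrightarrow> u \<in> Agents \<and> r \<in> Res \<and> formula \<phi>"

definition partial_resource_monoid :: "'r set \<Rightarrow> ('r \<Rightarrow> 'r \<Rightarrow> 'r option) \<Rightarrow> bool" where
  "partial_resource_monoid R m \<longleftrightarrow>
     Res \<subseteq> R \<and>
     (\<forall>r1\<in>R. \<forall>r2\<in>R. \<forall>r. m r1 r2 = Some r \<longrightarrow> r \<in> R) \<and>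
     (\<forall>r1\<in>Res. \<forall>r2\<in>Res. \<forall>r3\<in>Res. rop r2 r3 = Some r1 \<longleftrightarrow> m r2 r3 = Some r1) \<and>
     (\<forall>r1\<in>R. m r1 e = Some r1) \<and>
     (\<forall>r1\<in>R. \<forall>r2\<in>R. \<forall>r. m r1 r2 = Some r \<longrightarrow> m r2 r1 = Some r) \<and>
     (\<forall>r1\<in>R. \<forall>r2\<in>R. \<forall>r3\<in>R. \<forall>s t. m r2 r3 = Some s \<and> m r1 s = Some t \<longrightarrow>
        (\<exists>q. m r1 r2 = Some q \<and> m q r3 = Some t))"

definition is_model :: "('p, 'a, 'r) model \<Rightarrow> bool" where
  "is_model M \<longleftrightarrow>
     partial_resource_monoid (Carr M) (comp M) \<and>
     (\<forall>u\<in>Agents. equiv (Carr M) (sim M u)) \<and>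
     (\<forall>p\<in>Props. val M p \<subseteq> Carr M)"

primrec sat :: "('p, 'a, 'r) model \<Rightarrow> 'r \<Rightarrow> ('p, 'a, 'r) form \<Rightarrow> bool" where
  "sat M r (Atom p) \<longleftrightarrow> r \<in> val M p"
| "sat M r Bot \<longleftrightarrow> False"
| "sat M r Top \<longleftrightarrow> True"
| "sat M r (Neg \<phi>) \<longleftrightarrow> \<not> sat M r \<phi>"
| "sat M r Emp \<longleftrightarrow> r = e"
| "sat M r (Or \<phi> \<psi>) \<longleftrightarrow> sat M r \<phi> \<or> sat M r \<psi>"
| "sat M r (And \<phi> \<psi>) \<longleftrightarrow> sat M r \<phi> \<and> sat M r \<psi>"
| "sat M r (Imp \<phi> \<psi>) \<longleftrightarrow> (sat M r \<phi> \<longrightarrow> sat M r \<psi>)"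
| "sat M r (Star \<phi> \<psi>) \<longleftrightarrow>
     (\<exists>r1\<in>Carr M. \<exists>r2\<in>Carr M. comp M r1 r2 = Some r \<and> sat M r1 \<phi> \<and> sat M r2 \<psi>)"
| "sat M r (Wand \<phi> \<psi>) \<longleftrightarrow>
     (\<forall>r'\<in>Carr M. \<forall>t. comp M r r' = Some t \<and> sat M r' \<phi> \<longrightarrow> sat M t \<psi>)"
| "sat M r (CMod u s \<phi>) \<longleftrightarrow>
     (\<forall>t. comp M r s = Some t \<longrightarrow> (\<forall>r'\<in>Carr M. (t, r') \<in> sim M u \<longrightarrow> sat M r' \<phi>))"
| "sat M r (DMod u s \<phi>) \<longleftrightarrow>
     (\<exists>r'\<in>Carr M. \<exists>t'. comp M r' s = Some t' \<and> (r, t') \<in> sim M u \<and> sat M t' \<phi>)"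
| "sat M r (EMod u s \<phi>) \<longleftrightarrow>
     (\<forall>t. comp M r s = Some t \<longrightarrow>
        (\<forall>r'\<in>Carr M. \<forall>t'. comp M r' s = Some t' \<and> (t, t') \<in> sim M u \<longrightarrow> sat M t' \<phi>))"

definition valid :: "('p, 'a, 'r) form \<Rightarrow> bool" where
  "valid \<phi> \<longleftrightarrow> (\<forall>M. is_model M \<longrightarrow> (\<forall>r\<in>Carr M. sat M r \<phi>))"

definition gamma :: "'k set" where
  "gamma = Lam \<union> c ` {1..}"

definition is_label :: "'k label \<Rightarrow> bool" where
  "is_label x \<longleftrightarrow> set_mset x \<subseteq> gamma"

fun is_constr :: "('a, 'k) constr \<Rightarrow> bool" where
  "is_constr (ResC x y) \<longleftrightarrow> is_label x \<and> is_label y"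
| "is_constr (AgC u x y) \<longleftrightarrow> u \<in> Agents \<and> is_label x \<and> is_label y"

inductive_set closure :: "('a, 'k) constr set \<Rightarrow> ('a, 'k) constr set"
  for C :: "('a, 'k) constr set" where
  base: "k \<in> C \<Longrightarrow> k \<in> closure C"
| eps: "ResC {#} {#} \<in> closure C"
| res_sym: "ResC x y \<in> closure C \<Longrightarrow> ResC y x \<in> closure C"
| sublabel: "ResC (x + y) (x + y) \<in> closure C \<Longrightarrow> ResC x x \<in> closure C"
| res_trans: "ResC x y \<in> closure C \<Longrightarrow> ResC y z \<in> closure C \<Longrightarrow> ResC x z \<in> closure C"
| compat: "ResC x y \<in> closure C \<Longrightarrow> ResC (y + k) (y + k) \<in> closure C \<Longrightarrow>
     ResC (x + k) (y + k) \<in> closure C"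
| ag_res: "AgC u x y \<in> closure C \<Longrightarrow> ResC x x \<in> closure C"
| ag_refl: "ResC x x \<in> closure C \<Longrightarrow> v \<in> Agents \<Longrightarrow> AgC v x x \<in> closure C"
| ag_sym: "AgC u x y \<in> closure C \<Longrightarrow> AgC u y x \<in> closure C"
| ag_trans: "AgC u x y \<in> closure C \<Longrightarrow> AgC u y z \<in> closure C \<Longrightarrow> AgC u x z \<in> closure C"
| ag_subst: "AgC u x y \<in> closure C \<Longrightarrow> ResC x k \<in> closure C \<Longrightarrow> AgC u k y \<in> closure C"

definition is_css :: "('p, 'a, 'r, 'k) css \<Rightarrow> bool" where
  "is_css B \<longleftrightarrow>
     (\<forall>(S, \<phi>, x)\<in>fst B. formula \<phi> \<and> is_label x \<and> ResC x x \<in> closure (snd B)) \<and>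
     (\<forall>k\<in>snd B. is_constr k)"

definition fresh :: "('a, 'k) constr set \<Rightarrow> 'k set" where
  "fresh C = gamma - (constants_of C \<union> Lam)"

text \<open>
  \<open>expands B Bs\<close>: some rule has its premise satisfied by the branch \<open>B\<close> and yields the list
  \<open>Bs\<close> of alternatives, each given by the labelled formulae and constraints to be added.
\<close>

inductive expands ::
  "('p, 'a, 'r, 'k) css \<Rightarrow> ('p, 'a, 'r, 'k) css list \<Rightarrow> bool" where
  T_Emp: "(TT, Emp, x) \<in> F \<Longrightarrow> expands (F, C) [({}, {ResC x {#}})]"
| T_Neg: "(TT, Neg \<phi>, x) \<in> F \<Longrightarrow> expands (F, C) [({(FF, \<phi>, x)}, {})]"
| F_Neg: "(FF, Neg \<phi>, x) \<in> F \<Longrightarrow> expands (F, C) [({(TT, \<phi>, x)}, {})]"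
| T_And: "(TT, And \<phi> \<psi>, x) \<in> F \<Longrightarrow> expands (F, C) [({(TT, \<phi>, x), (TT, \<psi>, x)}, {})]"
| F_And: "(FF, And \<phi> \<psi>, x) \<in> F \<Longrightarrow>
    expands (F, C) [({(FF, \<phi>, x)}, {}), ({(FF, \<psi>, x)}, {})]"
| T_Or: "(TT, Or \<phi> \<psi>, x) \<in> F \<Longrightarrow>
    expands (F, C) [({(TT, \<phi>, x)}, {}), ({(TT, \<psi>, x)}, {})]"
| F_Or: "(FF, Or \<phi> \<psi>, x) \<in> F \<Longrightarrow> expands (F, C) [({(FF, \<phi>, x), (FF, \<psi>, x)}, {})]"
| T_Imp: "(TT, Imp \<phi> \<psi>, x) \<in> F \<Longrightarrow>
    expands (F, C) [({(FF, \<phi>, x)}, {}), ({(TT, \<psi>, x)}, {})]"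
| F_Imp: "(FF, Imp \<phi> \<psi>, x) \<in> F \<Longrightarrow> expands (F, C) [({(TT, \<phi>, x), (FF, \<psi>, x)}, {})]"
| T_Star: "(TT, Star \<phi> \<psi>, x) \<in> F \<Longrightarrow> a \<in> fresh C \<Longrightarrow> b \<in> fresh C \<Longrightarrow> a \<noteq> b \<Longrightarrow>
    expands (F, C) [({(TT, \<phi>, {#a#}), (TT, \<psi>, {#b#})}, {ResC x ({#a#} + {#b#})})]"
| F_Star: "(FF, Star \<phi> \<psi>, x) \<in> F \<Longrightarrow> ResC x (y + z) \<in> closure C \<Longrightarrow>
    expands (F, C) [({(FF, \<phi>, y)}, {}), ({(FF, \<psi>, z)}, {})]"
| T_Wand: "(TT, Wand \<phi> \<psi>, x) \<in> F \<Longrightarrow> ResC (x + y) (x + y) \<in> closure C \<Longrightarrow>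
    expands (F, C) [({(FF, \<phi>, y)}, {}), ({(TT, \<psi>, x + y)}, {})]"
| F_Wand: "(FF, Wand \<phi> \<psi>, x) \<in> F \<Longrightarrow> a \<in> fresh C \<Longrightarrow>
    expands (F, C)
      [({(TT, \<phi>, {#a#}), (FF, \<psi>, x + {#a#})}, {ResC (x + {#a#}) (x + {#a#})})]"
| T_C: "(TT, CMod u r \<phi>, x) \<in> F \<Longrightarrow> AgC u (x + lam r) y \<in> closure C \<Longrightarrow>
    expands (F, C) [({(TT, \<phi>, y)}, {})]"
| F_C: "(FF, CMod u r \<phi>, x) \<in> F \<Longrightarrow> a \<in> fresh C \<Longrightarrow>
    expands (F, C) [({(FF, \<phi>, {#a#})}, {AgC u (x + lam r) {#a#}})]"
| T_D: "(TT, DMod u r \<phi>, x) \<in> F \<Longrightarrow> a \<in> fresh C \<Longrightarrow>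
    expands (F, C) [({(TT, \<phi>, {#a#} + lam r)}, {AgC u x ({#a#} + lam r)})]"
| F_D: "(FF, DMod u r \<phi>, x) \<in> F \<Longrightarrow> AgC u x (y + lam r) \<in> closure C \<Longrightarrow>
    expands (F, C) [({(FF, \<phi>, y + lam r)}, {})]"
| T_E: "(TT, EMod u r \<phi>, x) \<in> F \<Longrightarrow> AgC u (x + lam r) (y + lam r) \<in> closure C \<Longrightarrow>
    expands (F, C) [({(TT, \<phi>, y + lam r)}, {})]"
| F_E: "(FF, EMod u r \<phi>, x) \<in> F \<Longrightarrow> a \<in> fresh C \<Longrightarrow>
    expands (F, C) [({(FF, \<phi>, {#a#} + lam r)}, {AgC u (x + lam r) ({#a#} + lam r)})]"
| T_CHat: "(TT, CHat u r \<phi>, x) \<in> F \<Longrightarrow> a \<in> fresh C \<Longrightarrow>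
    expands (F, C) [({(TT, \<phi>, {#a#})}, {AgC u (x + lam r) {#a#}})]"
| F_CHat: "(FF, CHat u r \<phi>, x) \<in> F \<Longrightarrow> AgC u (x + lam r) y \<in> closure C \<Longrightarrow>
    expands (F, C) [({(FF, \<phi>, y)}, {})]"
| T_DHat: "(TT, DHat u r \<phi>, x) \<in> F \<Longrightarrow> AgC u x (y + lam r) \<in> closure C \<Longrightarrow>
    expands (F, C) [({(TT, \<phi>, y + lam r)}, {})]"
| F_DHat: "(FF, DHat u r \<phi>, x) \<in> F \<Longrightarrow> a \<in> fresh C \<Longrightarrow>
    expands (F, C) [({(FF, \<phi>, {#a#} + lam r)}, {AgC u x ({#a#} + lam r)})]"
| T_EHat: "(TT, EHat u r \<phi>, x) \<in> F \<Longrightarrow> a \<in> fresh C \<Longrightarrow>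
    expands (F, C) [({(TT, \<phi>, {#a#} + lam r)}, {AgC u (x + lam r) ({#a#} + lam r)})]"
| F_EHat: "(FF, EHat u r \<phi>, x) \<in> F \<Longrightarrow> AgC u (x + lam r) (y + lam r) \<in> closure C \<Longrightarrow>
    expands (F, C) [({(FF, \<phi>, y + lam r)}, {})]"

inductive tableau ::
  "('p, 'a, 'r, 'k) css \<Rightarrow> ('p, 'a, 'r, 'k) css list \<Rightarrow> bool"
  for B0 :: "('p, 'a, 'r, 'k) css" where
  init: "is_css B0 \<Longrightarrow> finite (fst B0) \<Longrightarrow> finite (snd B0) \<Longrightarrow> tableau B0 [B0]"
| expand: "tableau B0 (Ts @ [(F, C)] @ Us) \<Longrightarrow> expands (F, C) Bs \<Longrightarrow>
    tableau B0 (Ts @ map (\<lambda>(F', C'). (F \<union> F', C \<union> C')) Bs @ Us)"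

definition css_closed :: "('p, 'a, 'r, 'k) css \<Rightarrow> bool" where
  "css_closed B \<longleftrightarrow>
     (\<exists>\<phi> x y. (TT, \<phi>, x) \<in> fst B \<and> (FF, \<phi>, y) \<in> fst B \<and> ResC x y \<in> closure (snd B)) \<or>
     (\<exists>x. (FF, Emp, x) \<in> fst B \<and> ResC x {#} \<in> closure (snd B)) \<or>
     (\<exists>x. (FF, Top, x) \<in> fst B) \<or>
     (\<exists>x. (TT, Bot, x) \<in> fst B)"

definition tableaux_proof :: "('p, 'a, 'r) form \<Rightarrow> ('p, 'a, 'r, 'k) css list \<Rightarrow> bool" where
  "tableaux_proof \<phi> Ts \<longleftrightarrow>
     tableau ({(FF, \<phi>, {#c 1#})}, {ResC {#c 1#} {#c 1#}}) Ts \<and> (\<forall>B\<in>set Ts. css_closed B)"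

end

end

(*
  Soundness by preserving realizability of some branch.  Interpret the constants in a
  countermodel, extend the interpretation to labels by composing values (undefinedness
  absorbs), and read constraints as definedness together with equality, respectively agent
  indistinguishability.  These readings respect the closure rules.  A rule with new constants
  is matched by reinterpreting these constants, which no label of the branch mentions.  A
  closed branch is not realizable, whereas the initial one is when the formula fails somewhere.
*)
theory Submission
  imports Defs
begin

text \<open>One model is fixed throughout, the candidate countermodel; validity results from letting
  it vary at the end.\<close>

locale erl_model = erl Agents Res e rop Props Lam c lam
  for Agents :: "'a set" and Res :: "'r set" and e :: 'r
    and rop :: "'r \<Rightarrow> 'r \<Rightarrow> 'r option" and Props :: "'p set"
    and Lam :: "'k set" and c :: "nat \<Rightarrow> 'k" and lam :: "'r \<Rightarrow> 'k label" +
  fixes M :: "('p, 'a, 'r) model"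
  assumes model: "is_model M"
begin

section \<open>Monoid and equivalence laws of the model\<close>

lemma Res_Carr: "r \<in> Res \<Longrightarrow> r \<in> Carr M"
  using model unfolding is_model_def partial_resource_monoid_def by blast

lemma e_Carr: "e \<in> Carr M"
  by (rule Res_Carr[OF e_in_Res])

lemma comp_closed: "r \<in> Carr M \<Longrightarrow> s \<in> Carr M \<Longrightarrow> comp M r s = Some t \<Longrightarrow> t \<in> Carr M"
  using model unfolding is_model_def partial_resource_monoid_def by blast

lemma comp_e: "r \<in> Carr M \<Longrightarrow> comp M r e = Some r"
  using model unfolding is_model_def partial_resource_monoid_def by blast

lemma comp_comm_Some:
  "r \<in> Carr M \<Longrightarrow> s \<in> Carr M \<Longrightarrow> comp M r s = Some t \<Longrightarrow> comp M s r = Some t"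
  using model unfolding is_model_def partial_resource_monoid_def by blast

lemma comp_comm:
  assumes "r \<in> Carr M" "s \<in> Carr M"
  shows "comp M r s = comp M s r"
  using comp_comm_Some[OF assms] comp_comm_Some[OF assms(2,1)]
  by (metis not_None_eq)

lemma comp_assoc_Some:
  assumes "r1 \<in> Carr M" "r2 \<in> Carr M" "r3 \<in> Carr M"
    and "comp M r2 r3 = Some s" "comp M r1 s = Some t"
  obtains q where "comp M r1 r2 = Some q" "comp M q r3 = Some t"
proof -
  have "\<forall>r1\<in>Carr M. \<forall>r2\<in>Carr M. \<forall>r3\<in>Carr M. \<forall>s t.
      comp M r2 r3 = Some s \<and> comp M r1 s = Some t \<longrightarrow>
      (\<exists>q. comp M r1 r2 = Some q \<and> comp M q r3 = Some t)"
    using model unfolding is_model_def partial_resource_monoid_def by (elim conjE)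
  with assms that show ?thesis by blast
qed

lemma sim_equiv: "u \<in> Agents \<Longrightarrow> equiv (Carr M) (sim M u)"
  using model unfolding is_model_def by blast

lemma sim_sym: "u \<in> Agents \<Longrightarrow> (r, s) \<in> sim M u \<Longrightarrow> (s, r) \<in> sim M u"
  using sim_equiv by (meson equivE symD)

lemma sim_trans:
  "u \<in> Agents \<Longrightarrow> (r, s) \<in> sim M u \<Longrightarrow> (s, t) \<in> sim M u \<Longrightarrow> (r, t) \<in> sim M u"
  using sim_equiv by (meson equivE transD)

lemma sim_refl: "u \<in> Agents \<Longrightarrow> r \<in> Carr M \<Longrightarrow> (r, r) \<in> sim M u"
  using sim_equiv by (meson equivE refl_onD)

text \<open>
  Cutting \<open>comp M\<close> down to the carrier makes \<open>ocomp\<close> associative and commutative on the whole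
  type, as folding over a multiset requires.
\<close>

definition ocomp :: "'r option \<Rightarrow> 'r option \<Rightarrow> 'r option" where
  "ocomp a b = (case (a, b) of
     (Some r, Some s) \<Rightarrow> if r \<in> Carr M \<and> s \<in> Carr M then comp M r s else None
   | _ \<Rightarrow> None)"

lemma ocomp_Some [simp]: "r \<in> Carr M \<Longrightarrow> s \<in> Carr M \<Longrightarrow> ocomp (Some r) (Some s) = comp M r s"
  by (simp add: ocomp_def)

lemma ocomp_eq_Some_iff:
  "ocomp a b = Some t \<longleftrightarrow>
     (\<exists>r\<in>Carr M. \<exists>s\<in>Carr M. a = Some r \<and> b = Some s \<and> comp M r s = Some t)"
  by (auto simp: ocomp_def split: option.splits)

lemma ocomp_comm: "ocomp a b = ocomp b a"
  by (auto simp: ocomp_def comp_comm split: option.splits)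

lemma ocomp_assoc_Some:
  assumes "ocomp a (ocomp b d) = Some t"
  shows "ocomp (ocomp a b) d = Some t"
  using assms by (auto simp: ocomp_eq_Some_iff) (metis comp_assoc_Some comp_closed)

text \<open>The monoid axiom transfers definedness only from right to left nesting. The converse is
  the same axiom read backwards through commutativity.\<close>

lemma ocomp_assoc: "ocomp (ocomp a b) d = ocomp a (ocomp b d)"
proof (cases "ocomp a (ocomp b d)")
  case (Some t)
  then show ?thesis by (simp add: ocomp_assoc_Some)
next
  case None
  have "ocomp (ocomp a b) d \<noteq> Some t" for t
  proof
    assume "ocomp (ocomp a b) d = Some t"
    \<comment> \<open>Mirroring turns the left-nested product into a right-nested one, to which the
      one-sided law applies; a second mirroring restores the order.\<close>
    then have "ocomp d (ocomp b a) = Some t" by (metis ocomp_comm)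
    from ocomp_assoc_Some[OF this] have "ocomp a (ocomp b d) = Some t" by (metis ocomp_comm)
    with None show False by simp
  qed
  with None show ?thesis by (cases "ocomp (ocomp a b) d") auto
qed

section \<open>Values of labels under an interpretation of the constants\<close>

definition eval :: "('k \<Rightarrow> 'r) \<Rightarrow> 'k label \<Rightarrow> 'r option" where
  "eval g x = fold_mset (\<lambda>k. ocomp (Some (g k))) (Some e) x"

lemma eval_empty [simp]: "eval g {#} = Some e"
  by (simp add: eval_def)

lemma eval_add_mset: "eval g (add_mset k x) = ocomp (Some (g k)) (eval g x)"
proof -
  \<comment> \<open>Left-commutativity of \<open>ocomp\<close> makes the fold independent of the
    order of letters.\<close>
  interpret comp_fun_commute "\<lambda>k. ocomp (Some (g k))"
    by unfold_locales (metis (no_types) comp_apply ext ocomp_assoc ocomp_comm)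
  show ?thesis by (simp add: eval_def)
qed

lemma eval_in_Carr: "range g \<subseteq> Carr M \<Longrightarrow> eval g x = Some r \<Longrightarrow> r \<in> Carr M"
  by (induction x arbitrary: r)
    (auto simp: e_Carr eval_add_mset ocomp_eq_Some_iff intro: comp_closed)

lemma eval_single: "range g \<subseteq> Carr M \<Longrightarrow> eval g {#k#} = Some (g k)"
  by (simp add: eval_add_mset e_Carr comp_e range_subsetD)

lemma eval_plus:
  assumes "range g \<subseteq> Carr M"
  shows "eval g (x + y) = ocomp (eval g x) (eval g y)"
proof (induction x)
  case empty
  show ?case
  \<comment> \<open>\<open>Some e\<close> is neutral for \<open>ocomp\<close> only against
    \<open>None\<close> and values in the carrier.\<close>
  proof (cases "eval g y")
    case (Some r)
    with assms have "r \<in> Carr M" by (rule eval_in_Carr)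
    with Some show ?thesis by (simp add: e_Carr comp_comm[of e] comp_e)
  qed (simp add: ocomp_def)
next
  case (add k x)
  then show ?case by (simp add: eval_add_mset ocomp_assoc)
qed

lemma eval_upd: "a \<notin># x \<Longrightarrow> eval (g(a := r)) x = eval g x"
  by (induction x) (auto simp: eval_add_mset)

text \<open>The modal rules refer to a resource \<open>r\<close> through the label
  \<open>lam r\<close>, so this label must denote \<open>r\<close> itself. Only constants outside
  \<open>Lam\<close> remain free to be reinterpreted.\<close>

definition admissible :: "('k \<Rightarrow> 'r) \<Rightarrow> bool" where
  "admissible g \<longleftrightarrow> range g \<subseteq> Carr M \<and> (\<forall>r\<in>Res. eval g (lam r) = Some r)"

lemma admissibleD:
  assumes "admissible g"
  shows "range g \<subseteq> Carr M" "r \<in> Res \<Longrightarrow> eval g (lam r) = Some r"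
  using assms by (auto simp: admissible_def)

lemma lam_subset_Lam:
  assumes "r \<in> Res"
  shows "set_mset (lam r) \<subseteq> Lam"
proof -
  have "lam r \<in> insert {#} ((\<lambda>k. {#k#}) ` Lam)"
    using bij_lam assms by (rule bij_betwE[THEN bspec])
  then show ?thesis by auto
qed

lemma admissible_upd:
  assumes "admissible g" "a \<notin> Lam" "r \<in> Carr M"
  shows "admissible (g(a := r))"
proof -
  have "eval (g(a := r)) (lam s) = Some s" if "s \<in> Res" for s
    using assms(1,2) that lam_subset_Lam[OF that] by (subst eval_upd) (auto simp: admissible_def)
  with assms(1,3) show ?thesis by (auto simp: admissible_def)
qed

text \<open>Bijectivity of \<open>lam\<close> dictates the values on \<open>Lam\<close>; every other
  constant may then take one arbitrary value.\<close>

lemma admissible_exists: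
  assumes "r0 \<in> Carr M"
  obtains g where "admissible g" "\<And>k. k \<notin> Lam \<Longrightarrow> g k = r0"
proof
  let ?g = "\<lambda>k. if k \<in> Lam then inv_into Res lam {#k#} else r0"
  show "?g k = r0" if "k \<notin> Lam" for k using that by simp
  have img: "lam ` Res = insert {#} ((\<lambda>k. {#k#}) ` Lam)" and inj: "inj_on lam Res"
    using bij_lam by (auto simp: bij_betw_def)
  have "inv_into Res lam {#k#} \<in> Res" if "k \<in> Lam" for k
    using that img by (intro inv_into_into) auto
  with assms have rng: "range ?g \<subseteq> Carr M" by (auto intro: Res_Carr)
  have "eval ?g (lam r) = Some r" if r: "r \<in> Res" for r
  proof -
    have "lam r \<in> insert {#} ((\<lambda>k. {#k#}) ` Lam)" using img r by blast
    then consider "lam r = {#}" | k where "k \<in> Lam" "lam r = {#k#}" by auto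
    then show ?thesis
    proof cases
      case 1
      \<comment> \<open>By injectivity \<open>e\<close> is the only resource named by the empty
        label, whose value is \<open>e\<close> by definition.\<close>
      with inj r have "r = e" by (metis e_in_Res inj_onD lam_e)
      with 1 show ?thesis by simp
    next
      case 2
      then have "inv_into Res lam {#k#} = r" using inj r by (metis inv_into_f_f)
      with 2 show ?thesis by (simp add: eval_single[OF rng])
    qed
  qed
  with rng show "admissible ?g" by (simp add: admissible_def)
qed

section \<open>Reading of constraints and soundness of the closure\<close>

fun holds :: "('k \<Rightarrow> 'r) \<Rightarrow> ('a, 'k) constr \<Rightarrow> bool" where
  "holds g (ResC x y) \<longleftrightarrow> (\<exists>r. eval g x = Some r \<and> eval g y = Some r)"
| "holds g (AgC u x y) \<longleftrightarrow>
     u \<in> Agents \<and> (\<exists>r s. eval g x = Some r \<and> eval g y = Some s \<and> (r, s) \<in> sim M u)"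

text \<open>Every closure rule is sound: parts of a defined composite are defined, labels of equal
  value compose alike with a third, and indistinguishability is an equivalence.\<close>

lemma holds_closure:
  assumes k: "k \<in> closure C" and g: "range g \<subseteq> Carr M" and C: "\<forall>k\<in>C. holds g k"
  shows "holds g k"
  using k
proof induction
  case (sublabel x y)
  then show ?case by (auto simp: eval_plus[OF g] ocomp_eq_Some_iff)
next
  case (compat x y k)
  then show ?case by (auto simp: eval_plus[OF g])
next
  case (ag_refl x v)
  then show ?case by (auto intro: sim_refl eval_in_Carr[OF g])
next
  \<comment> \<open>\<open>sim M u\<close> is known to be an equivalence only for agents, which is
    why \<open>holds\<close> records \<open>u \<in> Agents\<close>.\<close>
  case (ag_sym u x y)
  then show ?case by (auto dest: sim_sym)
next
  case (ag_trans u x y z)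
  then show ?case by (auto dest: sim_trans)
qed (use C in auto)

text \<open>No closure rule invents a constant. Hence a label that a tableau rule picks from the
  closure uses only constants of the branch.\<close>

lemma closure_labels:
  "k \<in> closure C \<Longrightarrow> (\<Union>x\<in>constr_labels k. set_mset x) \<subseteq> constants_of C"
proof (induction rule: closure.induct)
  case (base k)
  then show ?case by (auto simp: constants_of_def)
qed simp_all

section \<open>Labelled formulae and realizable branches\<close>

fun lholds :: "('k \<Rightarrow> 'r) \<Rightarrow> ('p, 'a, 'r, 'k) lform \<Rightarrow> bool" where
  "lholds g (S, \<phi>, x) \<longleftrightarrow> formula \<phi> \<and> (\<exists>r. eval g x = Some r \<and> (sat M r \<phi> \<longleftrightarrow> S = TT))"

text \<open>The last conjunct is what makes constants that are fresh for \<open>C\<close> fresh for \<open>F\<close>.\<close>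

definition realizes :: "('k \<Rightarrow> 'r) \<Rightarrow> ('p, 'a, 'r, 'k) css \<Rightarrow> bool" where
  "realizes g B \<longleftrightarrow> admissible g \<and> (\<forall>k\<in>snd B. holds g k) \<and> (\<forall>l\<in>fst B. lholds g l) \<and>
     (\<forall>(S, \<phi>, x)\<in>fst B. set_mset x \<subseteq> constants_of (snd B))"

lemma realizes_closure: "realizes g (F, C) \<Longrightarrow> k \<in> closure C \<Longrightarrow> holds g k"
  by (rule holds_closure) (auto simp: realizes_def admissible_def)

lemma holds_upd:
  assumes "holds g k" "k \<in> C" "a \<notin> constants_of C"
  shows "holds (g(a := r)) k"
  using assms by (cases k) (auto simp: eval_upd constants_of_def)

text \<open>A fresh constant lies outside \<open>Lam\<close>, so names keep their resources; it
  occurs in no constraint and therefore in no labelled formula, so all values on the branch stay the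
  same.\<close>

lemma realizes_upd:
  assumes "realizes g (F, C)" "a \<in> fresh C" "r \<in> Carr M"
  shows "realizes (g(a := r)) (F, C)"
proof -
  have a: "a \<notin> Lam" "a \<notin> constants_of C" using assms(2) by (auto simp: fresh_def)
  have "lholds (g(a := r)) (S, \<phi>, x)" if "(S, \<phi>, x) \<in> F" for S \<phi> x
  proof -
    have "a \<notin># x" using assms(1) a(2) that by (auto simp: realizes_def)
    with assms(1) that show ?thesis by (auto simp: realizes_def eval_upd)
  qed
  moreover have "admissible (g(a := r))"
    using assms(1,3) a(1) by (auto simp: realizes_def intro: admissible_upd)
  ultimately show ?thesis
    using assms(1) a(2) by (auto simp: realizes_def intro: holds_upd)
qed

lemma constants_of_Un: "constants_of (C \<union> D) = constants_of C \<union> constants_of D"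
  by (auto simp: constants_of_def)

lemma realizes_Un:
  assumes "realizes g (F, C)" "\<forall>k\<in>C'. holds g k" "\<forall>l\<in>F'. lholds g l"
    and "\<forall>(S, \<phi>, x)\<in>F'. set_mset x \<subseteq> constants_of (C \<union> C')"
  shows "realizes g (F \<union> F', C \<union> C')"
proof -
  have "\<forall>(S, \<phi>, x)\<in>F. set_mset x \<subseteq> constants_of (C \<union> C')"
    using assms(1) unfolding realizes_def constants_of_Un by auto
  with assms show ?thesis by (simp add: realizes_def ball_Un)
qed

lemma constants_of_singleton: "constants_of {k} = (\<Union>x\<in>constr_labels k. set_mset x)"
  by (simp add: constants_of_def)

text \<open>Since \<open>formula\<close> is carried along, decomposing a modal formula also yields
  that its indices lie in \<open>Agents\<close> and \<open>Res\<close>.\<close>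

lemma realizes_formulaD:
  assumes "realizes g (F, C)" "(S, \<phi>, x) \<in> F"
  shows "formula \<phi> \<and> (\<exists>r\<in>Carr M. eval g x = Some r \<and> (sat M r \<phi> \<longleftrightarrow> S = TT)) \<and>
    set_mset x \<subseteq> constants_of C"
proof -
  have "lholds g (S, \<phi>, x)" "set_mset x \<subseteq> constants_of C" "range g \<subseteq> Carr M"
    using assms by (auto simp: realizes_def admissible_def)
  then show ?thesis by (auto intro: eval_in_Carr)
qed

lemma realizes_admissible: "realizes g B \<Longrightarrow> admissible g"
  by (simp add: realizes_def)

section \<open>Preservation of realizability by the rules\<close>

lemma eval_plus_lam:
  assumes "admissible g" "eval g x = Some r" "s \<in> Res"
  shows "eval g (x + lam s) = comp M r s"
  using assms eval_in_Carr[OF admissibleD(1)]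
  by (simp add: eval_plus admissibleD Res_Carr)

lemma eval_single_lam:
  assumes "admissible g" "s \<in> Res"
  shows "eval g (add_mset a (lam s)) = comp M (g a) s"
  using eval_plus_lam[OF assms(1) eval_single[OF admissibleD(1)[OF assms(1)]] assms(2)] by simp

lemma eval_plus_lamD:
  assumes "admissible g" "s \<in> Res" "eval g (y + lam s) = Some t"
  shows "\<exists>r\<in>Carr M. comp M r s = Some t"
  using assms by (auto simp: eval_plus admissibleD ocomp_eq_Some_iff)

text \<open>For rules that add only formulae: the interpretation is kept, and the alternative has an
  empty constraint part.\<close>

lemma realizes_old:
  assumes "realizes g (F, C)" "\<forall>l\<in>F'. lholds g l"
    and "\<forall>(S, \<phi>, x)\<in>F'. set_mset x \<subseteq> constants_of C"
  shows "\<exists>g. realizes g (F \<union> F', C \<union> {})"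
  using realizes_Un[of g F C "{}" F'] assms by auto

text \<open>For rules with one new constant and one new constraint.\<close>

lemma realizes_new:
  assumes "realizes g (F, C)" "a \<in> fresh C" "r \<in> Carr M"
    and "holds (g(a := r)) k" "\<forall>l\<in>F'. lholds (g(a := r)) l"
    and "\<forall>(S, \<phi>, x)\<in>F'. set_mset x \<subseteq> constants_of C \<union> constants_of {k}"
  shows "\<exists>g. realizes g (F \<union> F', C \<union> {k})"
proof
  show "realizes (g(a := r)) (F \<union> F', C \<union> {k})"
    by (rule realizes_Un[OF realizes_upd[OF assms(1-3)]])
      (use assms(4-) in \<open>auto simp only: constants_of_Un singleton_iff\<close>)
qed

text \<open>The truth value of the premise at the value of its label either selects an alternative
  or supplies resources for the new constants.\<close>

lemma realizes_expands:
  assumes "expands (F, C) Bs" and real: "realizes g (F, C)"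
  shows "\<exists>(F', C')\<in>set Bs. \<exists>g. realizes g (F \<union> F', C \<union> C')"
proof -
  note adm = realizes_admissible[OF real]
  note fD = realizes_formulaD[OF real]
  note old = realizes_old[OF real]
  note new = realizes_new[OF real]
  note cl = realizes_closure[OF real]
  have upd: "eval (g(a := q)) x = eval g x" if "a \<in> fresh C" "set_mset x \<subseteq> constants_of C" for a q x
    using that by (intro eval_upd) (auto simp: fresh_def)
  have adm': "admissible (g(a := q))" if "a \<in> fresh C" "q \<in> Carr M" for a q
    using that by (intro admissible_upd adm) (auto simp: fresh_def)
  have sgl: "eval (g(a := q)) {#a#} = Some q" if "a \<in> fresh C" "q \<in> Carr M" for a q
    using eval_single[OF admissibleD(1)[OF adm'[OF that]], of a] by simp
  have sgl_lam: "eval (g(a := q)) (add_mset a (lam s)) = comp M q s"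
    if "a \<in> fresh C" "q \<in> Carr M" "s \<in> Res" for a q s
    using eval_single_lam[OF adm'[OF that(1,2)] that(3), of a] by simp
  have upd_lam: "eval (g(a := q)) (x + lam s) = comp M r s"
    if "a \<in> fresh C" "q \<in> Carr M" "set_mset x \<subseteq> constants_of C" "eval g x = Some r" "s \<in> Res"
    for a q x r s
    using that by (intro eval_plus_lam adm') (simp_all add: upd)
  show ?thesis
    using assms(1)
  proof cases
    \<comment> \<open>Only \<open>e\<close> satisfies \<open>Emp\<close>, so the added constraint
      already holds under \<open>g\<close>.\<close>
    case (T_Emp x)
    with fD[OF T_Emp(2)] show ?thesis
      using realizes_Un[OF real, of "{ResC x {#}}" "{}"] by auto
  next
    case (T_Neg \<phi> x)
    with fD[OF T_Neg(2)] show ?thesis using old[of "{(FF, \<phi>, x)}"] by auto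
  next
    case (F_Neg \<phi> x)
    with fD[OF F_Neg(2)] show ?thesis using old[of "{(TT, \<phi>, x)}"] by auto
  next
    case (T_And \<phi> \<psi> x)
    with fD[OF T_And(2)] show ?thesis using old[of "{(TT, \<phi>, x), (TT, \<psi>, x)}"] by auto
  next
    case (F_And \<phi> \<psi> x)
    with fD[OF F_And(2)] show ?thesis
      using old[of "{(FF, \<phi>, x)}"] old[of "{(FF, \<psi>, x)}"] by auto
  next
    case (T_Or \<phi> \<psi> x)
    with fD[OF T_Or(2)] show ?thesis
      using old[of "{(TT, \<phi>, x)}"] old[of "{(TT, \<psi>, x)}"] by auto
  next
    case (F_Or \<phi> \<psi> x)
    with fD[OF F_Or(2)] show ?thesis using old[of "{(FF, \<phi>, x), (FF, \<psi>, x)}"] by auto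
  next
    case (T_Imp \<phi> \<psi> x)
    with fD[OF T_Imp(2)] show ?thesis
      using old[of "{(FF, \<phi>, x)}"] old[of "{(TT, \<psi>, x)}"] by auto
  next
    case (F_Imp \<phi> \<psi> x)
    with fD[OF F_Imp(2)] show ?thesis using old[of "{(TT, \<phi>, x), (FF, \<psi>, x)}"] by auto
  next
    case (T_Star \<phi> \<psi> x a b)
    obtain r where f: "formula \<phi>" "formula \<psi>" and x: "eval g x = Some r"
      "set_mset x \<subseteq> constants_of C" and "sat M r (Star \<phi> \<psi>)"
      using fD[OF T_Star(2)] by auto
    then obtain r1 r2 where r12: "r1 \<in> Carr M" "r2 \<in> Carr M" "comp M r1 r2 = Some r"
      "sat M r1 \<phi>" "sat M r2 \<psi>"
      by auto
    \<comment> \<open>The new constants denote the two factors of \<open>r\<close>. As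
      \<open>C\<close> is not yet extended, \<open>b\<close> is still fresh after \<open>a\<close>
      is updated, and \<open>a \<noteq> b\<close> keeps the updates apart.\<close>
    let ?g = "g(a := r1, b := r2)"
    have real': "realizes ?g (F, C)"
      by (intro realizes_upd real T_Star r12)
    have rng: "range ?g \<subseteq> Carr M"
      by (rule admissibleD(1)[OF realizes_admissible[OF real']])
    have "eval ?g x = Some r"
      using x T_Star by (subst eval_upd) (auto simp: upd fresh_def)
    moreover have "eval ?g {#a#} = Some r1" "eval ?g {#b#} = Some r2"
      using eval_single[OF rng] T_Star(5) by auto
    moreover from this have "eval ?g ({#a#} + {#b#}) = Some r"
      using r12 by (simp only: eval_plus[OF rng] ocomp_Some)
    ultimately have "realizes ?g (F \<union> {(TT, \<phi>, {#a#}), (TT, \<psi>, {#b#})},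
        C \<union> {ResC x ({#a#} + {#b#})})"
      using f r12 by (intro realizes_Un[OF real']) (auto simp: constants_of_def)
    with T_Star(1) show ?thesis by auto
  next
    case (F_Star \<phi> \<psi> x y z)
    obtain r where f: "formula \<phi>" "formula \<psi>" and x: "eval g x = Some r"
      and ns: "\<not> sat M r (Star \<phi> \<psi>)"
      using fD[OF F_Star(2)] by auto
    \<comment> \<open>The constraint factors \<open>r\<close> into the values of \<open>y\<close>
      and \<open>z\<close>; since the star fails at \<open>r\<close>, one factor falsifies its
      conjunct and selects the branch.\<close>
    from cl[OF F_Star(3)] x obtain s t where st: "s \<in> Carr M" "t \<in> Carr M"
      "eval g y = Some s" "eval g z = Some t" "comp M s t = Some r"
      by (auto simp: eval_plus[OF admissibleD(1)[OF adm]] ocomp_eq_Some_iff)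
    have "\<not> sat M s \<phi> \<or> \<not> sat M t \<psi>" using ns st by auto
    moreover have "set_mset y \<subseteq> constants_of C" "set_mset z \<subseteq> constants_of C"
      using closure_labels[OF F_Star(3)] by auto
    ultimately show ?thesis
      using F_Star(1) f st old[of "{(FF, \<phi>, y)}"] old[of "{(FF, \<psi>, z)}"] by auto
  next
    case (T_Wand \<phi> \<psi> x y)
    obtain r where f: "formula \<phi>" "formula \<psi>" and x: "eval g x = Some r"
      and sw: "sat M r (Wand \<phi> \<psi>)"
      using fD[OF T_Wand(2)] by auto
    \<comment> \<open>Definedness of the composite label makes the value of \<open>y\<close> a
      legitimate argument of the wand.\<close>
    from cl[OF T_Wand(3)] x obtain s t where st: "s \<in> Carr M"
      "eval g y = Some s" "eval g (x + y) = Some t" "comp M r s = Some t"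
      by (auto simp: eval_plus[OF admissibleD(1)[OF adm]] ocomp_eq_Some_iff)
    have "\<not> sat M s \<phi> \<or> sat M t \<psi>" using sw st by auto
    moreover have "set_mset y \<subseteq> constants_of C" "set_mset (x + y) \<subseteq> constants_of C"
      using closure_labels[OF T_Wand(3)] by auto
    ultimately show ?thesis
      using T_Wand(1) f st old[of "{(FF, \<phi>, y)}"] old[of "{(TT, \<psi>, x + y)}"] by auto
  next
    case (F_Wand \<phi> \<psi> x a)
    obtain r where f: "formula \<phi>" "formula \<psi>" and x: "eval g x = Some r" "r \<in> Carr M"
      "set_mset x \<subseteq> constants_of C" and "\<not> sat M r (Wand \<phi> \<psi>)"
      using fD[OF F_Wand(2)] by auto
    \<comment> \<open>The argument \<open>s\<close> refuting the wand becomes the value of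
      \<open>a\<close>.\<close>
    then obtain s t where st: "s \<in> Carr M" "comp M r s = Some t" "sat M s \<phi>" "\<not> sat M t \<psi>"
      by auto
    have rng: "range (g(a := s)) \<subseteq> Carr M"
      by (rule admissibleD(1)[OF adm'[OF F_Wand(3) st(1)]])
    have "eval (g(a := s)) (x + {#a#}) = Some t"
      using x st F_Wand(3) by (simp only: eval_plus[OF rng] upd sgl ocomp_Some)
    then show ?thesis
      using F_Wand(1) f x(3) st sgl[OF F_Wand(3) st(1)]
        new[OF F_Wand(3) st(1), of "ResC (x + {#a#}) (x + {#a#})"
          "{(TT, \<phi>, {#a#}), (FF, \<psi>, x + {#a#})}"]
      by (auto simp: constants_of_singleton)
  next
    case (T_C u s \<phi> x y)
    with fD[OF T_C(2)] cl[OF T_C(3)] closure_labels[OF T_C(3)] show ?thesis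
      using old[of "{(TT, \<phi>, y)}"] eval_in_Carr[OF admissibleD(1)[OF adm], of y]
      by (auto simp: eval_plus_lam[OF adm])
  next
    \<comment> \<open>A false \<open>CHat\<close> is a true \<open>CMod\<close> of the negation, so
      this is the previous case with the sign flipped. The other modalities pair up in the same
      way.\<close>
    case (F_CHat u s \<phi> x y)
    with fD[OF F_CHat(2)] cl[OF F_CHat(3)] closure_labels[OF F_CHat(3)] show ?thesis
      using old[of "{(FF, \<phi>, y)}"] eval_in_Carr[OF admissibleD(1)[OF adm], of y]
      by (auto simp: eval_plus_lam[OF adm])
  next
    \<comment> \<open>The value of \<open>y + lam s\<close> is some carrier element composed with
      \<open>s\<close>, hence among the points over which \<open>DMod\<close> ranges.\<close>
    case (F_D u s \<phi> x y)
    with fD[OF F_D(2)] cl[OF F_D(3)] closure_labels[OF F_D(3)] show ?thesis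
      using old[of "{(FF, \<phi>, y + lam s)}"] eval_plus_lamD[OF adm, of s y] by auto
  next
    case (T_DHat u s \<phi> x y)
    with fD[OF T_DHat(2)] cl[OF T_DHat(3)] closure_labels[OF T_DHat(3)] show ?thesis
      using old[of "{(TT, \<phi>, y + lam s)}"] eval_plus_lamD[OF adm, of s y] by auto
  next
    case (T_E u s \<phi> x y)
    with fD[OF T_E(2)] cl[OF T_E(3)] closure_labels[OF T_E(3)] show ?thesis
      using old[of "{(TT, \<phi>, y + lam s)}"] eval_plus_lamD[OF adm, of s y]
      by (auto simp: eval_plus_lam[OF adm])
  next
    case (F_EHat u s \<phi> x y)
    with fD[OF F_EHat(2)] cl[OF F_EHat(3)] closure_labels[OF F_EHat(3)] show ?thesis
      using old[of "{(FF, \<phi>, y + lam s)}"] eval_plus_lamD[OF adm, of s y]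
      by (auto simp: eval_plus_lam[OF adm])
  next
    case (F_C u s \<phi> x a)
    obtain r where f: "formula \<phi>" "u \<in> Agents" "s \<in> Res" and x: "eval g x = Some r"
      "set_mset x \<subseteq> constants_of C" and "\<not> sat M r (CMod u s \<phi>)"
      using fD[OF F_C(2)] by auto
    \<comment> \<open>The new constant denotes the indistinguishable point \<open>q\<close> at which
      \<open>\<phi>\<close> fails.\<close>
    then obtain t q where q: "q \<in> Carr M" "comp M r s = Some t" "(t, q) \<in> sim M u" "\<not> sat M q \<phi>"
      by auto
    show ?thesis
      using F_C(1) f q x upd_lam[OF F_C(3) q(1) x(2,1) f(3)] sgl[OF F_C(3) q(1)]
        new[OF F_C(3) q(1), of "AgC u (x + lam s) {#a#}" "{(FF, \<phi>, {#a#})}"]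
      by (auto simp: constants_of_singleton)
  next
    case (T_CHat u s \<phi> x a)
    obtain r where f: "formula \<phi>" "u \<in> Agents" "s \<in> Res" and x: "eval g x = Some r"
      "set_mset x \<subseteq> constants_of C" and "sat M r (CHat u s \<phi>)"
      using fD[OF T_CHat(2)] by auto
    then obtain t q where q: "q \<in> Carr M" "comp M r s = Some t" "(t, q) \<in> sim M u" "sat M q \<phi>"
      by auto
    show ?thesis
      using T_CHat(1) f q x upd_lam[OF T_CHat(3) q(1) x(2,1) f(3)] sgl[OF T_CHat(3) q(1)]
        new[OF T_CHat(3) q(1), of "AgC u (x + lam s) {#a#}" "{(TT, \<phi>, {#a#})}"]
      by (auto simp: constants_of_singleton)
  next
    case (T_D u s \<phi> x a)
    obtain r where f: "formula \<phi>" "u \<in> Agents" "s \<in> Res" and x: "eval g x = Some r"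
      "set_mset x \<subseteq> constants_of C" and "sat M r (DMod u s \<phi>)"
      using fD[OF T_D(2)] by auto
    \<comment> \<open>The new constant denotes the factor \<open>q\<close>; the point
      \<open>t\<close> where \<open>\<phi>\<close> holds is the value of
      \<open>{#a#} + lam s\<close>.\<close>
    then obtain q t where q: "q \<in> Carr M" "comp M q s = Some t" "(r, t) \<in> sim M u" "sat M t \<phi>"
      by auto
    show ?thesis
      using T_D(1) f q x upd[OF T_D(3) x(2)] sgl_lam[OF T_D(3) q(1) f(3)]
        new[OF T_D(3) q(1), of "AgC u x ({#a#} + lam s)" "{(TT, \<phi>, {#a#} + lam s)}"]
      by (auto simp: constants_of_singleton)
  next
    case (F_DHat u s \<phi> x a)
    obtain r where f: "formula \<phi>" "u \<in> Agents" "s \<in> Res" and x: "eval g x = Some r"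
      "set_mset x \<subseteq> constants_of C" and "\<not> sat M r (DHat u s \<phi>)"
      using fD[OF F_DHat(2)] by auto
    then obtain q t where q: "q \<in> Carr M" "comp M q s = Some t" "(r, t) \<in> sim M u" "\<not> sat M t \<phi>"
      by auto
    show ?thesis
      using F_DHat(1) f q x upd[OF F_DHat(3) x(2)] sgl_lam[OF F_DHat(3) q(1) f(3)]
        new[OF F_DHat(3) q(1), of "AgC u x ({#a#} + lam s)" "{(FF, \<phi>, {#a#} + lam s)}"]
      by (auto simp: constants_of_singleton)
  next
    case (F_E u s \<phi> x a)
    obtain r where f: "formula \<phi>" "u \<in> Agents" "s \<in> Res" and x: "eval g x = Some r"
      "set_mset x \<subseteq> constants_of C" and "\<not> sat M r (EMod u s \<phi>)"
      using fD[OF F_E(2)] by auto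
    \<comment> \<open>Again \<open>a\<close> denotes the factor \<open>q\<close>, and the related
      points \<open>t\<close> and \<open>t'\<close> both arise by composition with
      \<open>s\<close>.\<close>
    then obtain t q t' where q: "q \<in> Carr M" "comp M r s = Some t" "comp M q s = Some t'"
      "(t, t') \<in> sim M u" "\<not> sat M t' \<phi>"
      by auto
    show ?thesis
      using F_E(1) f q x upd_lam[OF F_E(3) q(1) x(2,1) f(3)] sgl_lam[OF F_E(3) q(1) f(3)]
        new[OF F_E(3) q(1), of "AgC u (x + lam s) ({#a#} + lam s)" "{(FF, \<phi>, {#a#} + lam s)}"]
      by (auto simp: constants_of_singleton)
  next
    case (T_EHat u s \<phi> x a)
    obtain r where f: "formula \<phi>" "u \<in> Agents" "s \<in> Res" and x: "eval g x = Some r"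
      "set_mset x \<subseteq> constants_of C" and "sat M r (EHat u s \<phi>)"
      using fD[OF T_EHat(2)] by auto
    then obtain t q t' where q: "q \<in> Carr M" "comp M r s = Some t" "comp M q s = Some t'"
      "(t, t') \<in> sim M u" "sat M t' \<phi>"
      by auto
    show ?thesis
      using T_EHat(1) f q x upd_lam[OF T_EHat(3) q(1) x(2,1) f(3)] sgl_lam[OF T_EHat(3) q(1) f(3)]
        new[OF T_EHat(3) q(1), of "AgC u (x + lam s) ({#a#} + lam s)" "{(TT, \<phi>, {#a#} + lam s)}"]
      by (auto simp: constants_of_singleton)
  qed
qed

section \<open>From closed tableaux to validity\<close>

lemma realizes_tableau:
  assumes "tableau B0 Ts" "realizes g B0"
  shows "\<exists>B\<in>set Ts. \<exists>g. realizes g B"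
  using assms
proof induction
  case (expand Ts F C Us Bs)
  from expand.IH[OF expand.prems] obtain B g where B: "B \<in> set (Ts @ [(F, C)] @ Us)" "realizes g B"
    by blast
  show ?case
  proof (cases "B = (F, C)")
    \<comment> \<open>If the realized branch is the one expanded, an alternative inherits
      realizability, possibly under another interpretation; otherwise the branch survives.\<close>
    case True
    with B(2) realizes_expands[OF expand.hyps(2)] obtain F' C' g'
      where "(F', C') \<in> set Bs" "realizes g' (F \<union> F', C \<union> C')"
      by blast
    then show ?thesis by force
  next
    case False
    with B show ?thesis by auto
  qed
qed auto

text \<open>Labels linked by a resource constraint share a value, so each closure condition would
  give some formula the wrong truth value at one resource.\<close>

lemma closed_not_realizes:
  assumes "css_closed B" "realizes g B"
  shows False
proof -
  obtain F C where B: "B = (F, C)" by (cases B)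
  note real = assms(2)[unfolded B]
  consider \<phi> x y where "(TT, \<phi>, x) \<in> F" "(FF, \<phi>, y) \<in> F" "ResC x y \<in> closure C"
    | x where "(FF, Emp, x) \<in> F" "ResC x {#} \<in> closure C"
    | x where "(FF, Top, x) \<in> F"
    | x where "(TT, Bot, x) \<in> F"
    using assms(1) unfolding css_closed_def B by auto
  then show False
  proof cases
    case 1
    with realizes_closure[OF real 1(3)] show False
      by (auto dest!: realizes_formulaD[OF real])
  next
    case 2
    with realizes_closure[OF real 2(2)] show False
      by (auto dest!: realizes_formulaD[OF real])
  qed (auto dest!: realizes_formulaD[OF real])
qed

lemma tableaux_proof_sat:
  assumes "formula \<phi>" "tableaux_proof \<phi> Ts" "r \<in> Carr M"
  shows "sat M r \<phi>"
proof (rule ccontr)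
  assume nsat: "\<not> sat M r \<phi>"
  obtain g where g: "admissible g" "\<And>k. k \<notin> Lam \<Longrightarrow> g k = r"
    using admissible_exists[OF assms(3)] by blast
  \<comment> \<open>Thus \<open>c 1\<close> is not a resource name and denotes \<open>r\<close>,
    where \<open>\<phi>\<close> fails.\<close>
  have "c 1 \<notin> Lam" using c_notin_Lam by auto
  then have "eval g {#c 1#} = Some r"
    using g(2) by (simp add: eval_single[OF admissibleD(1)[OF g(1)]])
  \<comment> \<open>The initial constraint is what places \<open>c 1\<close> among the constants of
    the branch.\<close>
  then have "realizes g ({(FF, \<phi>, {#c 1#})}, {ResC {#c 1#} {#c 1#}})"
    using assms(1) nsat g(1) by (simp add: realizes_def constants_of_singleton)
  with realizes_tableau assms(2) obtain B g' where "css_closed B" "realizes g' B"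
    unfolding tableaux_proof_def by blast
  then show False by (rule closed_not_realizes)
qed

end

theorem theorem1:
  fixes Agents :: "'a set" and Res :: "'r set" and e :: 'r
    and rop :: "'r \<Rightarrow> 'r \<Rightarrow> 'r option" and Props :: "'p set"
    and Lam :: "'k set" and c :: "nat \<Rightarrow> 'k" and lam :: "'r \<Rightarrow> 'k label"
    and \<phi> :: "('p, 'a, 'r) form"
  assumes "erl Agents Res e rop Props Lam c lam"
    and "erl.formula Agents Res Props \<phi>"
    and "\<exists>Ts. erl.tableaux_proof Agents Res Props Lam c lam \<phi> Ts"
  shows "erl.valid Agents Res e rop Props \<phi>"
proof -
  interpret erl Agents Res e rop Props Lam c lam by (rule assms(1))
  obtain Ts where Ts: "tableaux_proof \<phi> Ts" using assms(3) by blast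
  have "sat M r \<phi>" if "is_model M" "r \<in> Carr M" for M r
  proof -
    interpret erl_model Agents Res e rop Props Lam c lam M by unfold_locales (rule that(1))
    show ?thesis by (rule tableaux_proof_sat[OF assms(2) Ts that(2)])
  qed
  then show ?thesis by (simp add: valid_def)
qed

end
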